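(* Let $f:\mathbb{R}^d\to\mathbb{R}$ be convex, let $\|\cdot\|$ be a norm on $\mathbb{R}^d$, $r>1$, $\mu>0$, $\delta\ge0$, and let $\psi:\mathbb{R}^d\to\mathbb{R}$ be a $\delta$-inexact $(\mu,r)$-uniformly convex regularizer with respect to $\|\cdot\|$. Let $\sigma,\sigma'\in[0,1/2)$ and let $\lambda_1,\lambda_2,\dots>0$ be proximal parameters. Then the iterates $y_t$, $t\ge1$, of the Non-Euclidean Accelerated Inexact Proximal Point algorithm (described in the context), started at any $x_0\in\mathbb{R}^d$, satisfy for every $u\in\mathbb{R}^d$ $$f(y_t)-f(u)=O_r\!\left(\frac{D_\psi(u,x_0)+\delta t}{\mu\left(\sum_{k=1}^t\lambda_k^{1/r}\right)^r}\right),$$ where the implied constant depends only on $r$ and the fixed constants $\sigma,\sigma'$. In particular, this holds with $u=x^\ast$ a minimizer of $f$, if one exists.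
   Context: $D_\psi(x,y)=\psi(x)-\psi(y)-\langle\nabla\psi(y),x-y\rangle$. A differentiable $\psi$ is $\delta$-inexact $(\mu,r)$-uniformly convex with respect to $\|\cdot\|$ if $D_\psi(x,y)\ge\frac{\mu}{r}\|x-y\|^r-\delta$ for all $x,y\in\mathbb{R}^d$. For $\gamma\ge0$, $\partial^{\gamma}f(y)=\{g: f(z)\ge f(y)+\langle g,z-y\rangle-\gamma\ \forall z\in\mathbb{R}^d\}$. Let $r_\ast=(1-1/r)^{-1}$ and let $\|\cdot\|_\ast$ be the dual norm. Inexact proximal oracle: $(y_k,v_k)\leftarrow\mathcal{O}_r(x_k,\lambda_k)$ returns $y_k$ and $v_k\in\partial^{\varepsilon_k}f(y_k)$ for some $\varepsilon_k\ge 0$ such that $$\|v_k-\hat v_k\|_\ast\le\tfrac{\sigma}{\lambda_k}\|x_k-y_k\|^{r-1}\ \text{ for some }\hat v_k\text{ with }-\hat v_k\in\partial_y\big(\tfrac{1}{r\lambda_k}\|y-x_k\|^r\big)(y_k),\qquad \varepsilon_k\le\tfrac{\sigma'}{\lambda_k}\|x_k-y_k\|^r .$$ Algorithm: set $z_0=y_0=x_0$, $A_0=0$, $C=\frac{\mu}{2}\left(\frac{r_\ast(1-\sigma-\sigma')}{1+\sigma^{r_\ast}}\right)^{r-1}$. For $k=1,2,\dots$: let $a_k>0$ and $A_k=A_{k-1}+a_k$ satisfy $a_k^r=C A_k^{r-1}\lambda_k$; set $x_k=\frac{A_{k-1}}{A_k}y_{k-1}+\frac{a_k}{A_k}z_{k-1}$;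 call $(y_k,v_k)\leftarrow\mathcal{O}_r(x_k,\lambda_k)$; set $z_k\in\arg\min_{z\in\mathbb{R}^d}\{\sum_{i=1}^k a_i\langle v_i,z\rangle+D_\psi(z,x_0)\}$. *)

theory Defs
  imports Complex_Main "Jordan_Normal_Form.Matrix"
begin

text \<open>Points of $R^d$ are elements of \<open>carrier_vec d\<close>, with the standard inner product
  \<open>scalar_prod\<close>. The dimension is a value and not a type, so that a constant can be
  chosen before the dimension. Functions on $R^d$ have type \<open>real vec \<Rightarrow> real\<close>; only their
  values on \<open>carrier_vec d\<close> matter.\<close>

definition is_norm :: "nat \<Rightarrow> (real vec \<Rightarrow> real) \<Rightarrow> bool" where
  "is_norm d N \<longleftrightarrow>
     (\<forall>x\<in>carrier_vec d. 0 \<le> N x) \<and>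
     (\<forall>x\<in>carrier_vec d. N x = 0 \<longleftrightarrow> x = 0\<^sub>v d) \<and>
     (\<forall>c. \<forall>x\<in>carrier_vec d. N (c \<cdot>\<^sub>v x) = \<bar>c\<bar> * N x) \<and>
     (\<forall>x\<in>carrier_vec d. \<forall>y\<in>carrier_vec d. N (x + y) \<le> N x + N y)"

definition dual_norm :: "nat \<Rightarrow> (real vec \<Rightarrow> real) \<Rightarrow> real vec \<Rightarrow> real" where
  "dual_norm d N v = Sup {scalar_prod v x | x. x \<in> carrier_vec d \<and> N x \<le> 1}"

definition convex_fun :: "nat \<Rightarrow> (real vec \<Rightarrow> real) \<Rightarrow> bool" where
  "convex_fun d f \<longleftrightarrow>
     (\<forall>x\<in>carrier_vec d. \<forall>y\<in>carrier_vec d. \<forall>t. 0 \<le> t \<and> t \<le> 1 \<longrightarrow>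
        f ((1 - t) \<cdot>\<^sub>v x + t \<cdot>\<^sub>v y) \<le> (1 - t) * f x + t * f y)"

definition eucl_norm :: "real vec \<Rightarrow> real" where
  "eucl_norm v = sqrt (scalar_prod v v)"

text \<open>Frechet differentiability at \<open>y\<close> with gradient \<open>g\<close>; as all norms on $R^d$ are equivalent,
  the Euclidean norm can be used here whatever norm is fixed elsewhere.\<close>

definition has_gradient :: "nat \<Rightarrow> (real vec \<Rightarrow> real) \<Rightarrow> real vec \<Rightarrow> real vec \<Rightarrow> bool" where
  "has_gradient d h y g \<longleftrightarrow>
     g \<in> carrier_vec d \<and>
     (\<forall>e>0. \<exists>s>0. \<forall>x\<in>carrier_vec d. eucl_norm (x - y) < s \<longrightarrow>
        \<bar>h x - h y - scalar_prod g (x - y)\<bar> \<le> e * eucl_norm (x - y))"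

definition differentiable_fun :: "nat \<Rightarrow> (real vec \<Rightarrow> real) \<Rightarrow> bool" where
  "differentiable_fun d h \<longleftrightarrow> (\<forall>y\<in>carrier_vec d. \<exists>g. has_gradient d h y g)"

definition gradient :: "nat \<Rightarrow> (real vec \<Rightarrow> real) \<Rightarrow> real vec \<Rightarrow> real vec" where
  "gradient d h y = (THE g. has_gradient d h y g)"

definition bregman :: "nat \<Rightarrow> (real vec \<Rightarrow> real) \<Rightarrow> real vec \<Rightarrow> real vec \<Rightarrow> real" where
  "bregman d \<psi> x y = \<psi> x - \<psi> y - scalar_prod (gradient d \<psi> y) (x - y)"

definition inexact_uniformly_convex ::
    "nat \<Rightarrow> (real vec \<Rightarrow> real) \<Rightarrow> real \<Rightarrow> real \<Rightarrow> real \<Rightarrow> (real vec \<Rightarrow> real) \<Rightarrow> bool" where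
  "inexact_uniformly_convex d N \<delta> \<mu> r \<psi> \<longleftrightarrow>
     differentiable_fun d \<psi> \<and>
     (\<forall>x\<in>carrier_vec d. \<forall>y\<in>carrier_vec d.
        bregman d \<psi> x y \<ge> \<mu> / r * N (x - y) powr r - \<delta>)"

definition eps_subdifferential ::
    "nat \<Rightarrow> real \<Rightarrow> (real vec \<Rightarrow> real) \<Rightarrow> real vec \<Rightarrow> real vec set" where
  "eps_subdifferential d \<gamma> f y =
     {g \<in> carrier_vec d. \<forall>z\<in>carrier_vec d. f z \<ge> f y + scalar_prod g (z - y) - \<gamma>}"

definition subdifferential :: "nat \<Rightarrow> (real vec \<Rightarrow> real) \<Rightarrow> real vec \<Rightarrow> real vec set" where
  "subdifferential d f y = eps_subdifferential d 0 f y"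

definition conj_exponent :: "real \<Rightarrow> real" where
  "conj_exponent r = 1 / (1 - 1 / r)"

text \<open>\<open>inexact_prox d N f r \<sigma> \<sigma>' x l y v\<close>: the pair \<open>(y, v)\<close> is an admissible answer of the
  oracle to the query \<open>(x, l)\<close>. Note that \<open>0 powr p = 0\<close>, so the powers of norms below are
  right at \<open>x = y\<close>, their exponents being positive.\<close>

definition inexact_prox ::
    "nat \<Rightarrow> (real vec \<Rightarrow> real) \<Rightarrow> (real vec \<Rightarrow> real) \<Rightarrow> real \<Rightarrow> real \<Rightarrow> real \<Rightarrow>
     real vec \<Rightarrow> real \<Rightarrow> real vec \<Rightarrow> real vec \<Rightarrow> bool" where
  "inexact_prox d N f r \<sigma> \<sigma>' x l y v \<longleftrightarrow>
     y \<in> carrier_vec d \<and>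
     (\<exists>\<epsilon>\<ge>0. v \<in> eps_subdifferential d \<epsilon> f y \<and> \<epsilon> \<le> \<sigma>' / l * N (x - y) powr r) \<and>
     (\<exists>w\<in>carrier_vec d.
        - w \<in> subdifferential d (\<lambda>y'. 1 / (r * l) * N (y' - x) powr r) y \<and>
        dual_norm d N (v - w) \<le> \<sigma> / l * N (x - y) powr (r - 1))"

definition step_constant :: "real \<Rightarrow> real \<Rightarrow> real \<Rightarrow> real \<Rightarrow> real" where
  "step_constant r \<mu> \<sigma> \<sigma>' =
     \<mu> / 2 * (conj_exponent r * (1 - \<sigma> - \<sigma>') / (1 + \<sigma> powr conj_exponent r)) powr (r - 1)"

text \<open>The starting point is \<open>x 0\<close>; the query points \<open>x k\<close> have \<open>k \<ge> 1\<close>.\<close>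

definition accelerated_prox_run ::
    "nat \<Rightarrow> (real vec \<Rightarrow> real) \<Rightarrow> (real vec \<Rightarrow> real) \<Rightarrow> (real vec \<Rightarrow> real) \<Rightarrow>
     real \<Rightarrow> real \<Rightarrow> real \<Rightarrow> real \<Rightarrow> (nat \<Rightarrow> real) \<Rightarrow> (nat \<Rightarrow> real) \<Rightarrow> (nat \<Rightarrow> real) \<Rightarrow>
     (nat \<Rightarrow> real vec) \<Rightarrow> (nat \<Rightarrow> real vec) \<Rightarrow> (nat \<Rightarrow> real vec) \<Rightarrow> (nat \<Rightarrow> real vec) \<Rightarrow> bool" where
  "accelerated_prox_run d N f \<psi> r \<mu> \<sigma> \<sigma>' l a A x y v z \<longleftrightarrow>
     x 0 \<in> carrier_vec d \<and> z 0 = x 0 \<and> y 0 = x 0 \<and> A 0 = 0 \<and>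
     (\<forall>k\<ge>1.
        a k > 0 \<and> A k = A (k - 1) + a k \<and>
        a k powr r = step_constant r \<mu> \<sigma> \<sigma>' * A k powr (r - 1) * l k \<and>
        x k = (A (k - 1) / A k) \<cdot>\<^sub>v y (k - 1) + (a k / A k) \<cdot>\<^sub>v z (k - 1) \<and>
        inexact_prox d N f r \<sigma> \<sigma>' (x k) (l k) (y k) (v k) \<and>
        is_arg_min (\<lambda>p. (\<Sum>i=1..k. a i * scalar_prod (v i) p) + bregman d \<psi> p (x 0))
          (\<lambda>p. p \<in> carrier_vec d) (z k))"

end

theory Submission
  imports Defs "HOL-Analysis.Convex"
begin

text \<open>Estimate sequence: let \<open>\<Phi> n p = (\<Sum>i=1..n. a i * (f (y i) + v i \<bullet> (p - y i) - \<epsilon> i)) + D p (x 0)\<close>,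
  where \<open>D\<close> is the Bregman divergence of \<open>\<psi>\<close>. It differs from \<open>\<psi>\<close> by an affine function and is
  minimal at \<open>z n\<close>, so \<open>\<Phi> n p = \<Phi> n (z n) + D p (z n)\<close>. Uniform convexity then gives
  \<open>A n * f (y n) \<le> \<Phi> n (z n) + n * \<delta>\<close> by induction: the progress of the oracle,
  \<open>A * (1 - \<sigma> - \<sigma>') / l * N (x - y) powr r\<close>, pays for the error term of Young's inequality
  exactly because of the choice of \<open>a\<close>. Comparing with \<open>\<Phi> t u\<close> bounds \<open>A t * (f (y t) - f u)\<close>, and
  \<open>A t\<close> is large because \<open>A k powr (1 / r)\<close> grows by at least a multiple of \<open>l k powr (1 / r)\<close>
  in every step.\<close>

section \<open>Power inequalities behind the step sizes\<close>

text \<open>Young's inequality with exponents \<open>r\<close> and \<open>r / (r - 1)\<close>, for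
  \<open>c\<close> and \<open>b powr (r - 1)\<close>. Geometrically, the tangent to the
  \<open>r\<close>-th power at \<open>b\<close> lies below the graph at \<open>c\<close>.\<close>

lemma powr_tangent:
  fixes r b c :: real
  assumes r: "r > 1" and b: "b \<ge> 0" and c: "c \<ge> 0"
  shows "r * (b powr (r - 1) * c) \<le> c powr r + (r - 1) * b powr r"
proof -
  have q: "1 / r + 1 / (r / (r - 1)) = 1" "r / (r - 1) > 1"
    using r by (auto simp: field_simps)
  have "c * b powr (r - 1) \<le> c powr r / r + (b powr (r - 1)) powr (r / (r - 1)) / (r / (r - 1))"
    using Youngs_inequality[OF r q(2) q(1) c, of "b powr (r - 1)"] by simp
  also have "(b powr (r - 1)) powr (r / (r - 1)) = b powr r"
    using r by (simp add: powr_powr)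
  finally have "r * (c * b powr (r - 1)) \<le> r * (c powr r / r + b powr r / (r / (r - 1)))"
    using r by (intro mult_left_mono) auto
  also have "\<dots> = c powr r + (r - 1) * b powr r"
    using r by (simp add: distrib_left)
  finally show ?thesis by (simp add: mult.commute mult.left_commute)
qed

lemma conj_exponent_eq: "r > 1 \<Longrightarrow> conj_exponent r = r / (r - 1)"
  by (simp add: conj_exponent_def field_simps)

text \<open>Convexity of the power \<open>q = r / (r - 1)\<close>: adding its tangent inequalities
  at the midpoint \<open>m\<close>, for the points \<open>1\<close> and \<open>s\<close>, gives
  \<open>2 * m powr q \<le> 1 + s powr q\<close>. Raising to the power \<open>r - 1\<close> turns
  the exponent \<open>q\<close> into \<open>r\<close>. For \<open>s = \<sigma>\<close> this explains
  the factor 1/2 and the denominator in \<open>step_constant\<close>.\<close>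

lemma powr_one_plus_le:
  fixes r s :: real
  assumes r: "r > 1" and s: "s \<ge> 0"
  shows "(1 + s) powr r \<le> 2 * (1 + s powr conj_exponent r) powr (r - 1)"
proof -
  define q where "q = r / (r - 1)"
  have q: "q > 1" "q * (r - 1) = r" using r by (auto simp: q_def field_simps)
  define m where "m = (1 + s) / 2"
  have m: "m > 0" and two_m: "2 * m = 1 + s" using s by (auto simp: m_def)
  have mq: "m powr (q - 1) * m = m powr q" using m q by (simp add: powr_mult_base mult.commute)
  have "q * (m powr (q - 1) * 1) + q * (m powr (q - 1) * s)
      \<le> (1 powr q + (q - 1) * m powr q) + (s powr q + (q - 1) * m powr q)"
    using q m s by (intro add_mono powr_tangent) auto
  moreover have "q * (m powr (q - 1) * 1) + q * (m powr (q - 1) * s) = 2 * q * (m powr (q - 1) * m)"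
    by (simp add: m_def algebra_simps)
  ultimately have *: "2 * m powr q \<le> 1 + s powr q"
    unfolding mq by (simp add: algebra_simps)
  have "2 * (1 + s powr q) powr (r - 1) \<ge> 2 * (2 * m powr q) powr (r - 1)"
    using * r m by (intro mult_left_mono powr_mono2) auto
  also have "2 * (2 * m powr q) powr (r - 1) = 2 * 2 powr (r - 1) * m powr r"
    using m q by (simp add: powr_mult powr_powr)
  also have "2 * 2 powr (r - 1) = (2::real) powr r"
    by (simp add: powr_mult_base)
  also have "2 powr r * m powr r = (1 + s) powr r"
    unfolding powr_mult[symmetric] two_m ..
  finally show ?thesis using r by (simp add: conj_exponent_eq q_def)
qed

lemma step_constant_pos:
  assumes "r > 1" "\<mu> > 0" "\<sigma> + \<sigma>' < 1"
  shows "step_constant r \<mu> \<sigma> \<sigma>' > 0"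
proof -
  have "1 + \<sigma> powr conj_exponent r > 0"
    by (smt (verit) powr_ge_zero)
  then show ?thesis using assms
    by (auto simp: step_constant_def conj_exponent_eq intro!: mult_pos_pos divide_pos_pos)
qed

text \<open>Divided by \<open>\<mu> / r\<close>, the claim reads \<open>r * g * D powr (r - 1) * P
  \<le> P powr r + (r - 1) * E * D powr r\<close> with the \<open>g\<close> and \<open>E\<close> of
  the proof. This follows from Young's inequality once \<open>g powr q \<le> E\<close>, and the
  equation for \<open>a\<close> yields exactly that.\<close>

lemma step_size_inequality:
  fixes r \<mu> \<sigma> \<sigma>' a A l D P :: real
  assumes r: "r > 1" and mu: "\<mu> > 0" and s: "0 \<le> \<sigma>" "\<sigma> + \<sigma>' < 1"
    and pos: "a > 0" "A > 0" "l > 0" "D \<ge> 0" "P \<ge> 0"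
    and step: "a powr r = step_constant r \<mu> \<sigma> \<sigma>' * A powr (r - 1) * l"
  shows "a * ((1 + \<sigma>) / l * D powr (r - 1) * P)
    \<le> A * ((1 - \<sigma> - \<sigma>') / l * D powr r) + \<mu> / r * P powr r"
proof -
  define q where "q = conj_exponent r"
  have q: "q > 0" "q * (r - 1) = r" using r by (auto simp: q_def conj_exponent_eq)
  define g where "g = a * (1 + \<sigma>) / (l * \<mu>)"
  have g: "g > 0" using pos mu s by (simp add: g_def)
  define E where "E = A * (1 - \<sigma> - \<sigma>') * q / (l * \<mu>)"
  have E: "E > 0" using pos mu s q by (simp add: E_def)
  have sq: "1 + \<sigma> powr q > 0" by (smt (verit) powr_ge_zero)
  have "g powr r = a powr r * (1 + \<sigma>) powr r / (l * \<mu>) powr r"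
    using pos mu s by (simp add: g_def powr_mult powr_divide)
  also have "\<dots> \<le> a powr r * (2 * (1 + \<sigma> powr q) powr (r - 1)) / (l * \<mu>) powr r"
    using powr_one_plus_le[OF r s(1)] unfolding q_def by (intro divide_right_mono mult_left_mono) auto
  \<comment> \<open>The equation for \<open>a powr r\<close> enters here: the factor 2 and the power
    of \<open>1 + \<sigma> powr q\<close> cancel against those in
    \<open>step_constant\<close>.\<close>
  also have "\<dots> = A powr (r - 1) * (q * (1 - \<sigma> - \<sigma>')) powr (r - 1) * (l * \<mu>) / (l * \<mu>) powr r"
    using sq s q by (simp add: step step_constant_def q_def[symmetric] powr_divide)
  also have "(l * \<mu>) powr r = (l * \<mu>) powr (r - 1) * (l * \<mu>)"
    using pos mu powr_mult_base[of "l * \<mu>" "r - 1"] by (simp add: mult.commute)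
  also have "A powr (r - 1) * (q * (1 - \<sigma> - \<sigma>')) powr (r - 1) * (l * \<mu>) / ((l * \<mu>) powr (r - 1) * (l * \<mu>))
      = E powr (r - 1)"
    using pos mu q s by (simp add: E_def powr_mult powr_divide)
  finally have "(g powr r) powr (1 / (r - 1)) \<le> (E powr (r - 1)) powr (1 / (r - 1))"
    using r by (intro powr_mono2) auto
  then have gE: "g powr q \<le> E"
    using r E by (simp add: powr_powr q_def conj_exponent_eq)
  \<comment> \<open>Chosen so that \<open>b powr (r - 1)\<close> absorbs the coefficient
    \<open>g\<close>; then \<open>b powr r\<close> carries the factor \<open>g powr q\<close>, which
    \<open>gE\<close> controls.\<close>
  define b where "b = g powr (1 / (r - 1)) * D"
  have b: "b \<ge> 0" using pos by (simp add: b_def)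
  have "b powr (r - 1) = g * D powr (r - 1)"
    using r pos g by (simp add: b_def powr_mult powr_powr)
  then have "a * ((1 + \<sigma>) / l * D powr (r - 1) * P) = \<mu> / r * (r * (b powr (r - 1) * P))"
    using r mu pos by (simp add: g_def)
  also have "\<dots> \<le> \<mu> / r * (P powr r + (r - 1) * b powr r)"
    using r mu pos b by (intro mult_left_mono powr_tangent) auto
  also have "b powr r = g powr q * D powr r"
    using r pos g by (simp add: b_def powr_mult powr_powr q_def conj_exponent_eq)
  also have "\<mu> / r * (P powr r + (r - 1) * (g powr q * D powr r))
      \<le> \<mu> / r * (P powr r + (r - 1) * (E * D powr r))"
    using gE r mu by (intro mult_left_mono add_left_mono mult_right_mono) auto
  also have "\<dots> = A * ((1 - \<sigma> - \<sigma>') / l * D powr r) + \<mu> / r * P powr r"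
    using r mu pos by (simp add: E_def q_def conj_exponent_eq field_simps)
  finally show ?thesis .
qed

text \<open>Let \<open>b\<close> and \<open>c\<close> be the \<open>r\<close>-th roots of the new
  and the old value of \<open>A\<close>. The tangent inequality gives
  \<open>a = b powr r - c powr r \<le> r * b powr (r - 1) * (b - c)\<close>, while the step equation
  gives \<open>a = C powr (1 / r) * b powr (r - 1) * l powr (1 / r)\<close>. Cancelling
  \<open>b powr (r - 1)\<close> leaves a lower bound on \<open>b - c\<close> that can be summed over
  the steps.\<close>

lemma root_growth:
  fixes r C :: real and a A l :: "nat \<Rightarrow> real"
  assumes r: "r > 1" and C: "C > 0" and A0: "A 0 = 0"
    and A: "\<And>k. k \<ge> 1 \<Longrightarrow> A k = A (k - 1) + a k" and a: "\<And>k. k \<ge> 1 \<Longrightarrow> a k > 0"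
    and l: "\<And>k. k \<ge> 1 \<Longrightarrow> l k > 0"
    and step: "\<And>k. k \<ge> 1 \<Longrightarrow> a k powr r = C * A k powr (r - 1) * l k"
  shows "C / r powr r * (\<Sum>k=1..t. l k powr (1 / r)) powr r \<le> A t"
proof -
  have A_nn: "A n \<ge> 0" for n
  proof (induction n)
    case (Suc n)
    then show ?case using A[of "Suc n"] a[of "Suc n"] by simp
  qed (simp add: A0)
  have main: "C powr (1 / r) / r * (\<Sum>k=1..n. l k powr (1 / r)) \<le> A n powr (1 / r)" for n
  proof (induction n)
    case (Suc n)
    define b where "b = A (Suc n) powr (1 / r)"
    define c where "c = A n powr (1 / r)"
    have An: "A (Suc n) = A n + a (Suc n)" "a (Suc n) > 0" "A (Suc n) > 0" "l (Suc n) > 0"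
      using A[of "Suc n"] a[of "Suc n"] l[of "Suc n"] A_nn[of n] by auto
    have bc: "b > 0" "c \<ge> 0" "b powr r = A (Suc n)" "c powr r = A n"
      using An A_nn[of n] r by (auto simp: b_def c_def powr_powr)
    have "a (Suc n) = (a (Suc n) powr r) powr (1 / r)"
      using An r by (simp add: powr_powr)
    also have "\<dots> = (C * A (Suc n) powr (r - 1) * l (Suc n)) powr (1 / r)"
      using step[of "Suc n"] by simp
    also have "\<dots> = C powr (1 / r) * b powr (r - 1) * l (Suc n) powr (1 / r)"
      using An C by (simp add: powr_mult powr_powr b_def)
    finally have a_eq: "a (Suc n) = C powr (1 / r) * b powr (r - 1) * l (Suc n) powr (1 / r)" .
    have "r * (b powr (r - 1) * c) \<le> c powr r + (r - 1) * b powr r"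
      using r bc by (intro powr_tangent) auto
    also have "\<dots> = r * (b powr (r - 1) * b) - a (Suc n)"
      using bc An powr_mult_base[of b "r - 1"] by (simp add: algebra_simps)
    finally have "b powr (r - 1) * (C powr (1 / r) * l (Suc n) powr (1 / r)) \<le> b powr (r - 1) * (r * (b - c))"
      by (simp add: a_eq algebra_simps)
    then have "C powr (1 / r) * l (Suc n) powr (1 / r) \<le> r * (b - c)"
      using bc by simp
    then have "C powr (1 / r) / r * l (Suc n) powr (1 / r) \<le> b - c"
      using r by (simp add: field_simps)
    then show ?case using Suc.IH by (simp add: distrib_left b_def c_def)
  qed simp
  have "C / r powr r * (\<Sum>k=1..t. l k powr (1 / r)) powr r
      = (C powr (1 / r) / r * (\<Sum>k=1..t. l k powr (1 / r))) powr r"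
    using r C by (simp add: powr_mult powr_divide powr_powr sum_nonneg)
  also have "\<dots> \<le> (A t powr (1 / r)) powr r"
    using r main by (intro powr_mono2) (auto intro!: mult_nonneg_nonneg divide_nonneg_nonneg sum_nonneg)
  also have "\<dots> = A t" using r A_nn[of t] by (simp add: powr_powr)
  finally show ?thesis .
qed

section \<open>Norms on R^d: comparison with coordinates, and duality\<close>

lemma is_normD:
  assumes "is_norm d N"
  shows is_norm_nonneg: "x \<in> carrier_vec d \<Longrightarrow> 0 \<le> N x"
    and is_norm_eq_0: "x \<in> carrier_vec d \<Longrightarrow> N x = 0 \<longleftrightarrow> x = 0\<^sub>v d"
    and is_norm_smult: "x \<in> carrier_vec d \<Longrightarrow> N (c \<cdot>\<^sub>v x) = \<bar>c\<bar> * N x"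
    and is_norm_triangle: "x \<in> carrier_vec d \<Longrightarrow> y \<in> carrier_vec d \<Longrightarrow> N (x + y) \<le> N x + N y"
  using assms unfolding is_norm_def by blast+

lemma is_norm_uminus:
  assumes "is_norm d N" "x \<in> carrier_vec d"
  shows "N (- x) = N x"
proof -
  have "- x = (-1) \<cdot>\<^sub>v x" by auto
  then show ?thesis using is_norm_smult[OF assms, of "-1"] by simp
qed

lemma is_norm_minus:
  assumes "is_norm d N" "x \<in> carrier_vec d" "y \<in> carrier_vec d"
  shows "N (x - y) \<le> N x + N y"
  using is_norm_triangle[OF assms(1,2), of "- y"] is_norm_uminus[OF assms(1,3)] assms
  by (simp add: minus_add_uminus_vec)

lemma is_norm_minus_commute:
  assumes "is_norm d N" "x \<in> carrier_vec d" "y \<in> carrier_vec d"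
  shows "N (x - y) = N (y - x)"
proof -
  have "x - y = - (y - x)" using assms by (intro eq_vecI) auto
  then show ?thesis using is_norm_uminus[OF assms(1), of "y - x"] assms by simp
qed

text \<open>The triangle inequality, applied to truncations of \<open>x\<close> that gain one
  coordinate at a time. It lets coordinatewise convergence imply convergence in
  \<open>N\<close>.\<close>

lemma is_norm_le_sum_coords:
  assumes N: "is_norm d N" and x: "x \<in> carrier_vec d"
  shows "N x \<le> (\<Sum>i<d. \<bar>x $ i\<bar> * N (unit_vec d i))"
proof -
  have "N (vec d (\<lambda>i. if i < n then x $ i else 0)) \<le> (\<Sum>i<n. \<bar>x $ i\<bar> * N (unit_vec d i))" if "n \<le> d" for n
    using that
  proof (induction n)
    case 0
    have "vec d (\<lambda>i. if i < 0 then x $ i else 0) = 0\<^sub>v d" by auto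
    then show ?case using is_norm_eq_0[OF N, of "0\<^sub>v d"] by simp
  next
    case (Suc n)
    have "vec d (\<lambda>i. if i < Suc n then x $ i else 0)
        = vec d (\<lambda>i. if i < n then x $ i else 0) + (x $ n) \<cdot>\<^sub>v unit_vec d n"
      using Suc.prems by (intro eq_vecI) (auto simp: less_Suc_eq)
    then have "N (vec d (\<lambda>i. if i < Suc n then x $ i else 0))
        \<le> N (vec d (\<lambda>i. if i < n then x $ i else 0)) + N ((x $ n) \<cdot>\<^sub>v unit_vec d n)"
      using is_norm_triangle[OF N] by simp
    then show ?case using Suc is_norm_smult[OF N, of "unit_vec d n"] by simp
  qed
  from this[of d] have "N (vec d (\<lambda>i. if i < d then x $ i else 0)) \<le> (\<Sum>i<d. \<bar>x $ i\<bar> * N (unit_vec d i))"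
    by simp
  also have "vec d (\<lambda>i. if i < d then x $ i else 0) = x" using x by (intro eq_vecI) auto
  finally show ?thesis .
qed

text \<open>Induction on the number of coordinates in use. In the step, if the next unit vector had
  distance 0 from the span of the earlier ones, vectors of that span realising the distance would be
  Cauchy in every coordinate, and their limit would be an element of the span at distance 0.\<close>

lemma is_norm_coord_bound:
  assumes N: "is_norm d N"
  shows "\<exists>c\<ge>0. \<forall>x\<in>carrier_vec d. \<forall>i<d. \<bar>x $ i\<bar> \<le> c * N x"
proof -
  \<comment> \<open>The span of the first \<open>n\<close> unit vectors. For \<open>n = d\<close>
    the condition on the coordinates is void, so \<open>S d\<close> is the whole space.\<close>
  define S where "S = (\<lambda>n. {x \<in> carrier_vec d. \<forall>j<d. n \<le> j \<longrightarrow> x $ j = (0::real)})"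
  have "\<exists>c\<ge>0. \<forall>x\<in>S n. \<forall>i<d. \<bar>x $ i\<bar> \<le> c * N x" if "n \<le> d" for n
    using that
  proof (induction n)
    case 0
    then show ?case by (intro exI[of _ 0]) (auto simp: S_def)
  next
    case (Suc n)
    then obtain c where c: "c \<ge> 0" "\<And>x i. x \<in> S n \<Longrightarrow> i < d \<Longrightarrow> \<bar>x $ i\<bar> \<le> c * N x" by force
    define e :: "real vec" where "e = unit_vec d n"
    have e: "e \<in> carrier_vec d" by (simp add: e_def)
    have "\<exists>\<eta>>0. \<forall>x\<in>S n. \<eta> \<le> N (e + x)"
    proof (rule ccontr)
      assume "\<not> ?thesis"
      then have "\<exists>x\<in>S n. N (e + x) < 1 / real (Suc m)" for m
        by (metis not_le of_nat_0_less_iff zero_less_Suc zero_less_divide_1_iff)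
      then obtain X where X: "\<And>m. X m \<in> S n" "\<And>m. N (e + X m) < 1 / real (Suc m)" by metis
      have Xc: "X m \<in> carrier_vec d" for m using X(1) by (simp add: S_def)
      have lim0: "(\<lambda>m. 1 / real (Suc m)) \<longlonglongrightarrow> 0"
        using LIMSEQ_inverse_real_of_nat by (simp add: inverse_eq_divide)
      have diff: "N (X m - X k) \<le> 1 / real (Suc m) + 1 / real (Suc k)" for m k
      proof -
        have "X m - X k = (e + X m) - (e + X k)"
          using Xc[of m] Xc[of k] e by (intro eq_vecI) auto
        then have "N (X m - X k) \<le> N (e + X m) + N (e + X k)"
          using is_norm_minus[OF N, of "e + X m" "e + X k"] Xc e by simp
        then show ?thesis using X(2)[of m] X(2)[of k] by simp
      qed
      have "convergent (\<lambda>m. X m $ i)" if i: "i < d" for i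
      proof (rule real_Cauchy_convergent, rule CauchyI)
        fix \<epsilon> :: real assume eps: "\<epsilon> > 0"
        have "(\<lambda>m. c * (1 / real (Suc m))) \<longlonglongrightarrow> c * 0" using lim0 by (intro tendsto_mult tendsto_const)
        then have "\<forall>\<^sub>F m in sequentially. c * (1 / real (Suc m)) < \<epsilon> / 2"
          using eps by (intro order_tendstoD) auto
        then obtain M where M: "\<And>m. m \<ge> M \<Longrightarrow> c * (1 / real (Suc m)) < \<epsilon> / 2"
          by (auto simp: eventually_sequentially)
        show "\<exists>M. \<forall>m\<ge>M. \<forall>k\<ge>M. norm (X m $ i - X k $ i) < \<epsilon>"
        proof (intro exI allI impI)
          fix m k assume mk: "m \<ge> M" "k \<ge> M"
          have "X m - X k \<in> S n" using X(1)[of m] X(1)[of k] by (auto simp: S_def)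
          then have "\<bar>(X m - X k) $ i\<bar> \<le> c * N (X m - X k)" using c i by blast
          also have "\<dots> \<le> c * (1 / real (Suc m) + 1 / real (Suc k))"
            using diff c(1) by (intro mult_left_mono)
          also have "\<dots> < \<epsilon>" unfolding distrib_left using M[OF mk(1)] M[OF mk(2)] by linarith
          finally show "norm (X m $ i - X k $ i) < \<epsilon>" using i Xc[of k] by simp
        qed
      qed
      then have L: "(\<lambda>m. X m $ i) \<longlonglongrightarrow> lim (\<lambda>m. X m $ i)" if "i < d" for i
        using that by (simp add: convergent_LIMSEQ_iff)
      define x where "x = vec d (\<lambda>i. lim (\<lambda>m. X m $ i))"
      have x: "x \<in> carrier_vec d" by (simp add: x_def)
      have "N (e + x) \<le> 1 / real (Suc m) + (\<Sum>i<d. \<bar>lim (\<lambda>m. X m $ i) - X m $ i\<bar> * N (unit_vec d i))" for m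
      proof -
        have "e + x = (e + X m) + (x - X m)" using e x Xc[of m] by (intro eq_vecI) auto
        then have "N (e + x) \<le> N (e + X m) + N (x - X m)"
          using is_norm_triangle[OF N, of "e + X m" "x - X m"] e x Xc[of m] by simp
        moreover have "N (x - X m) \<le> (\<Sum>i<d. \<bar>(x - X m) $ i\<bar> * N (unit_vec d i))"
          using x Xc[of m] by (intro is_norm_le_sum_coords[OF N]) auto
        moreover have "\<dots> = (\<Sum>i<d. \<bar>lim (\<lambda>m. X m $ i) - X m $ i\<bar> * N (unit_vec d i))"
          using Xc[of m] by (intro sum.cong) (auto simp: x_def)
        ultimately show ?thesis using X(2)[of m] by simp
      qed
      moreover have "(\<lambda>m. 1 / real (Suc m) + (\<Sum>i<d. \<bar>lim (\<lambda>m. X m $ i) - X m $ i\<bar> * N (unit_vec d i)))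
          \<longlonglongrightarrow> 0 + (\<Sum>i<d. \<bar>lim (\<lambda>m. X m $ i) - lim (\<lambda>m. X m $ i)\<bar> * N (unit_vec d i))"
        using L lim0 by (intro tendsto_intros) auto
      ultimately have "N (e + x) \<le> 0"
        by (intro LIMSEQ_le_const) auto
      then have "e + x = 0\<^sub>v d"
        using is_norm_nonneg[OF N, of "e + x"] is_norm_eq_0[OF N, of "e + x"] e x by simp
      \<comment> \<open>Coordinate \<open>n\<close> gives the contradiction: it is 1 in
        \<open>e\<close>, and 0 in every \<open>X m\<close> and hence in the limit
        \<open>x\<close>.\<close>
      then have "(e + x) $ n = 0" using Suc.prems by simp
      moreover have "x $ n = 0"
        using L[of n] X(1) Suc.prems LIMSEQ_unique[of "\<lambda>m. X m $ n" "x $ n" 0]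
        by (simp add: x_def S_def)
      ultimately show False using Suc.prems x by (simp add: e_def)
    qed
    then obtain \<eta> where eta: "\<eta> > 0" "\<And>x. x \<in> S n \<Longrightarrow> \<eta> \<le> N (e + x)" by blast
    \<comment> \<open>Split \<open>x = t * e + w\<close> with \<open>w\<close> in
      \<open>S n\<close>. Dividing by \<open>t\<close> puts \<open>x\<close> at coordinate 1 in
      direction \<open>e\<close>, so \<open>\<bar>t\<bar> \<le> N x / \<eta>\<close>. The
      coordinates of \<open>w\<close> are at most \<open>c * N w\<close>, where
      \<open>N w \<le> N x + \<bar>t\<bar> * N e\<close>. Adding both bounds gives
      \<open>c'\<close>.\<close>
    define c' where "c' = 1 / \<eta> + c * (1 + N e / \<eta>)"
    have Ne: "N e \<ge> 0" using is_norm_nonneg[OF N e] .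
    have "\<bar>x $ i\<bar> \<le> c' * N x" if x: "x \<in> S (Suc n)" and i: "i < d" for x i
    proof -
      define t where "t = x $ n"
      have xc: "x \<in> carrier_vec d" using x by (simp add: S_def)
      have Nx: "N x \<ge> 0" using is_norm_nonneg[OF N xc] .
      have w: "x - t \<cdot>\<^sub>v e \<in> S n"
        using x e by (auto simp: S_def t_def e_def not_less_eq_eq[symmetric] le_less)
      have t: "\<bar>t\<bar> \<le> N x / \<eta>"
      proof (cases "t = 0")
        case False
        have "(1 / t) \<cdot>\<^sub>v (x - t \<cdot>\<^sub>v e) \<in> S n"
          using w e xc by (auto simp: S_def simp del: index_minus_vec(1))
        then have "\<eta> \<le> N (e + (1 / t) \<cdot>\<^sub>v (x - t \<cdot>\<^sub>v e))" by (rule eta)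
        also have "e + (1 / t) \<cdot>\<^sub>v (x - t \<cdot>\<^sub>v e) = (1 / t) \<cdot>\<^sub>v x"
          using False e xc by (intro eq_vecI) (auto simp: field_simps)
        also have "N \<dots> = \<bar>1 / t\<bar> * N x" using is_norm_smult[OF N xc] .
        finally show ?thesis using False eta by (simp add: field_simps)
      qed (use Nx eta in auto)
      have "\<bar>x $ i\<bar> \<le> \<bar>t\<bar> + \<bar>(x - t \<cdot>\<^sub>v e) $ i\<bar>"
        using i e Suc.prems by (auto simp: e_def t_def)
      also have "\<bar>(x - t \<cdot>\<^sub>v e) $ i\<bar> \<le> c * N (x - t \<cdot>\<^sub>v e)" using c(2)[OF w i] .
      also have "N (x - t \<cdot>\<^sub>v e) \<le> N x + \<bar>t\<bar> * N e"
        using is_norm_minus[OF N xc, of "t \<cdot>\<^sub>v e"] is_norm_smult[OF N e] e by simp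
      also have "\<bar>t\<bar> * N e \<le> N x / \<eta> * N e" using t Ne by (intro mult_right_mono)
      finally have "\<bar>x $ i\<bar> \<le> \<bar>t\<bar> + c * (N x + N x / \<eta> * N e)"
        using c(1) by (simp add: mult_left_mono)
      then show ?thesis using t by (simp add: c'_def algebra_simps)
    qed
    moreover have "c' \<ge> 0" using c(1) eta(1) Ne by (simp add: c'_def)
    ultimately show ?case by blast
  qed
  from this[of d] show ?thesis by (simp add: S_def)
qed

text \<open>After scaling \<open>p\<close> to norm 1 this is membership in the set whose supremum is
  the dual norm. The supremum is an upper bound only if that set is bounded above, which follows
  from the coordinate bound on the unit ball.\<close>

lemma scalar_prod_le_dual_norm:
  assumes N: "is_norm d N" and v: "v \<in> carrier_vec d" and p: "p \<in> carrier_vec d"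
  shows "scalar_prod v p \<le> dual_norm d N v * N p"
proof (cases "p = 0\<^sub>v d")
  case True
  then show ?thesis using v is_norm_eq_0[OF N, of "0\<^sub>v d"] by simp
next
  case False
  then have Np: "N p > 0" using is_norm_nonneg[OF N p] is_norm_eq_0[OF N p] by simp
  obtain c where c: "c \<ge> 0" "\<And>x i. x \<in> carrier_vec d \<Longrightarrow> i < d \<Longrightarrow> \<bar>x $ i\<bar> \<le> c * N x"
    using is_norm_coord_bound[OF N] by blast
  have bdd: "bdd_above {scalar_prod v x | x. x \<in> carrier_vec d \<and> N x \<le> 1}"
  proof (rule bdd_aboveI)
    fix s assume "s \<in> {scalar_prod v x | x. x \<in> carrier_vec d \<and> N x \<le> 1}"
    then obtain x where x: "x \<in> carrier_vec d" "N x \<le> 1" "s = scalar_prod v x" by blast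
    have "s \<le> (\<Sum>i=0..<d. \<bar>v $ i\<bar> * c)"
      unfolding x(3) scalar_prod_def using x(1)
    proof (simp, intro sum_mono)
      fix i assume i: "i \<in> {0..<d}"
      then have "\<bar>x $ i\<bar> \<le> c * N x" using c(2)[OF x(1)] by simp
      also have "\<dots> \<le> c" using c(1) x(2) mult_left_mono[of "N x" 1 c] by simp
      finally have "\<bar>v $ i\<bar> * \<bar>x $ i\<bar> \<le> \<bar>v $ i\<bar> * c" by (intro mult_left_mono) auto
      then show "v $ i * x $ i \<le> \<bar>v $ i\<bar> * c" by (simp add: abs_mult[symmetric])
    qed
    then show "s \<le> (\<Sum>i=0..<d. \<bar>v $ i\<bar> * c)" .
  qed
  have "N ((1 / N p) \<cdot>\<^sub>v p) = 1" using is_norm_smult[OF N p] Np by simp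
  then have "scalar_prod v ((1 / N p) \<cdot>\<^sub>v p) \<le> dual_norm d N v"
    unfolding dual_norm_def using p by (intro cSup_upper[OF _ bdd] CollectI exI[of _ "(1 / N p) \<cdot>\<^sub>v p"]) auto
  then show ?thesis using v p Np by (simp add: field_simps)
qed

section \<open>Consequences of the oracle conditions\<close>

text \<open>The subgradient inequality is tested in two ways. On the ray from \<open>x\<close>
  through \<open>y\<close> the function is a multiple of an \<open>r\<close>-th power, which
  determines the inner product exactly. Small moves from \<open>y\<close> in direction
  \<open>- p\<close> bound \<open>w\<close> on every \<open>p\<close>.\<close>

lemma prox_subgradient:
  assumes N: "is_norm d N" and r: "r > 1" and l: "l > 0"
    and c: "x \<in> carrier_vec d" "y \<in> carrier_vec d" "w \<in> carrier_vec d"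
    and w: "- w \<in> subdifferential d (\<lambda>y'. 1 / (r * l) * N (y' - x) powr r) y"
  shows prox_subgradient_inner: "scalar_prod w (x - y) = N (x - y) powr r / l"
    and prox_subgradient_bound:
      "p \<in> carrier_vec d \<Longrightarrow> scalar_prod w p \<le> N (x - y) powr (r - 1) / l * N p"
proof -
  define q where "q = x - y"
  define D where "D = N q"
  have q: "q \<in> carrier_vec d" using c by (simp add: q_def)
  have D: "D \<ge> 0" using is_norm_nonneg[OF N q] by (simp add: D_def)
  have sub: "1 / (r * l) * D powr r + scalar_prod (- w) (z - y) \<le> 1 / (r * l) * N (z - x) powr r"
    if "z \<in> carrier_vec d" for z
    using w that is_norm_minus_commute[OF N c(1,2)]
    by (auto simp: subdifferential_def eps_subdifferential_def D_def q_def)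
  define W where "W = scalar_prod w q"
  \<comment> \<open>The subgradient inequality at \<open>x - \<tau> * q\<close> says
    \<open>F 1 \<le> F \<tau>\<close>. So \<open>F\<close> has a local minimum at 1, and its
    vanishing derivative there gives \<open>W = D powr r / l\<close>.\<close>
  define F where "F = (\<lambda>\<tau>. 1 / (r * l) * D powr r * \<tau> powr r + (1 - \<tau>) * W)"
  have F: "F 1 \<le> F \<tau>" if "\<tau> > 0" for \<tau>
  proof -
    have "x - \<tau> \<cdot>\<^sub>v q - x = (- \<tau>) \<cdot>\<^sub>v q" "x - \<tau> \<cdot>\<^sub>v q - y = (1 - \<tau>) \<cdot>\<^sub>v q"
      using c by (auto simp: q_def algebra_simps)
    moreover have "N ((- \<tau>) \<cdot>\<^sub>v q) = \<tau> * D" using is_norm_smult[OF N q, of "- \<tau>"] that by (simp add: D_def)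
    ultimately show ?thesis using sub[of "x - \<tau> \<cdot>\<^sub>v q"] c q that D
      by (simp add: F_def W_def powr_mult algebra_simps)
  qed
  have "(F has_real_derivative (1 / (r * l) * D powr r * r - W)) (at 1)"
    unfolding F_def by (auto intro!: derivative_eq_intros simp del: times_divide_eq_left)
  then have "1 / (r * l) * D powr r * r - W = 0"
    by (rule DERIV_local_min[of _ _ _ 1]) (use F in auto)
  then show "scalar_prod w (x - y) = N (x - y) powr r / l"
    using r by (simp add: W_def D_def q_def)
  assume p: "p \<in> carrier_vec d"
  define P where "P = N p"
  have P: "P \<ge> 0" using is_norm_nonneg[OF N p] by (simp add: P_def)
  \<comment> \<open>At \<open>y - s * p\<close> the distance to \<open>x\<close> is at most
    \<open>b = D + s * P\<close>. The tangent at \<open>b\<close> bounds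
    \<open>b powr r - D powr r\<close> by \<open>r * b powr (r - 1) * (s * P)\<close>; division by
    \<open>s\<close> leaves a bound in which \<open>s\<close> can tend to 0.\<close>
  have bound: "scalar_prod w p \<le> (D + s * P) powr (r - 1) / l * P" if s: "s > 0" for s
  proof -
    define b where "b = D + s * P"
    have b: "b \<ge> 0" using D P s by (simp add: b_def)
    have "y - s \<cdot>\<^sub>v p - x = - (q + s \<cdot>\<^sub>v p)" "y - s \<cdot>\<^sub>v p - y = - (s \<cdot>\<^sub>v p)"
      using c p by (auto simp: q_def)
    moreover have "N (- (q + s \<cdot>\<^sub>v p)) \<le> b"
      using is_norm_uminus[OF N, of "q + s \<cdot>\<^sub>v p"] is_norm_triangle[OF N q, of "s \<cdot>\<^sub>v p"]
        is_norm_smult[OF N p, of s] q p s by (simp add: b_def D_def P_def)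
    then have "N (- (q + s \<cdot>\<^sub>v p)) powr r \<le> b powr r"
      using r p q is_norm_nonneg[OF N, of "- (q + s \<cdot>\<^sub>v p)"] by (intro powr_mono2) auto
    then have "1 / (r * l) * N (- (q + s \<cdot>\<^sub>v p)) powr r \<le> 1 / (r * l) * b powr r"
      using r l by (intro mult_left_mono) auto
    ultimately have "s * scalar_prod w p \<le> 1 / (r * l) * (b powr r - D powr r)"
      using sub[of "y - s \<cdot>\<^sub>v p"] c p by (simp add: algebra_simps)
    also have "\<dots> \<le> 1 / (r * l) * (r * b powr (r - 1) * (s * P))"
    proof (rule mult_left_mono)
      have "b powr (r - 1) * b = b powr r" using b powr_mult_base[of b "r - 1"] by (simp add: mult.commute)
      moreover have "r * b powr (r - 1) * (s * P) = r * (b powr (r - 1) * b) - r * (b powr (r - 1) * D)"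
        by (simp add: b_def algebra_simps)
      ultimately have "r * b powr (r - 1) * (s * P) = r * b powr r - r * (b powr (r - 1) * D)"
        by simp
      then show "b powr r - D powr r \<le> r * b powr (r - 1) * (s * P)"
        using powr_tangent[OF r b D] by (simp add: algebra_simps)
    qed (use r l in simp)
    also have "\<dots> = s * (b powr (r - 1) / l * P)"
      using r l by simp
    finally show ?thesis using s by (simp add: b_def mult_le_cancel_left_pos del: times_divide_eq_left)
  qed
  have "scalar_prod w p \<le> (D + 1 / real (Suc n) * P) powr (r - 1) / l * P" for n
    by (rule bound) simp
  moreover have "(\<lambda>n. (D + 1 / real (Suc n) * P) powr (r - 1) / l * P) \<longlonglongrightarrow> (D + 0 * P) powr (r - 1) / l * P"
  proof -
    have "(\<lambda>n. 1 / real (Suc n)) \<longlonglongrightarrow> 0"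
      using LIMSEQ_inverse_real_of_nat by (simp add: inverse_eq_divide)
    \<comment> \<open>For \<open>x = y\<close> the base tends to 0; the power still converges
      because the base is nonnegative and the exponent \<open>r - 1\<close> is positive.\<close>
    then show ?thesis using r l D P by (intro tendsto_intros tendsto_powr') auto
  qed
  ultimately have "scalar_prod w p \<le> (D + 0 * P) powr (r - 1) / l * P"
    by (intro LIMSEQ_le_const) blast+
  then show "scalar_prod w p \<le> N (x - y) powr (r - 1) / l * N p"
    by (simp add: D_def P_def q_def)
qed

text \<open>The exact subgradient \<open>w\<close> satisfies both bounds with
  \<open>\<sigma>\<close> and \<open>\<sigma>'\<close> equal to 0. Passing to \<open>v\<close>
  changes each by \<open>\<sigma> / l\<close> times a power of \<open>D\<close>, and
  \<open>\<epsilon>\<close> costs at most \<open>\<sigma>' / l * D powr r\<close>.\<close>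

lemma inexact_prox_bounds:
  assumes N: "is_norm d N" and r: "r > 1" and l: "l > 0" and x: "x \<in> carrier_vec d"
    and prox: "inexact_prox d N f r \<sigma> \<sigma>' x l y v"
  shows "\<exists>\<epsilon>. v \<in> eps_subdifferential d \<epsilon> f y
    \<and> (1 - \<sigma> - \<sigma>') / l * N (x - y) powr r + \<epsilon> \<le> scalar_prod v (x - y)
    \<and> (\<forall>p\<in>carrier_vec d. - scalar_prod v p \<le> (1 + \<sigma>) / l * N (x - y) powr (r - 1) * N p)"
proof -
  from prox obtain \<epsilon> w where y: "y \<in> carrier_vec d"
    and v: "v \<in> eps_subdifferential d \<epsilon> f y" and eps: "\<epsilon> \<le> \<sigma>' / l * N (x - y) powr r"
    and w: "w \<in> carrier_vec d" "- w \<in> subdifferential d (\<lambda>y'. 1 / (r * l) * N (y' - x) powr r) y"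
    and dual: "dual_norm d N (v - w) \<le> \<sigma> / l * N (x - y) powr (r - 1)"
    unfolding inexact_prox_def by blast
  have vc: "v \<in> carrier_vec d" using v by (simp add: eps_subdifferential_def)
  define D where "D = N (x - y)"
  have D: "D \<ge> 0" using is_norm_nonneg[OF N, of "x - y"] x y by (simp add: D_def)
  have DD: "D powr (r - 1) * D = D powr r"
    using D powr_mult_base[of D "r - 1"] by (simp add: mult.commute)
  have vw: "- (\<sigma> / l * D powr (r - 1) * N p) \<le> scalar_prod v p - scalar_prod w p" if p: "p \<in> carrier_vec d" for p
  proof -
    \<comment> \<open>The dual norm bounds inner products from above, so the lower bound for
      \<open>p\<close> comes from testing with \<open>- p\<close>.\<close>
    have "scalar_prod (v - w) (- p) \<le> dual_norm d N (v - w) * N (- p)"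
      using vc w p by (intro scalar_prod_le_dual_norm[OF N]) auto
    also have "\<dots> \<le> \<sigma> / l * D powr (r - 1) * N p"
      unfolding is_norm_uminus[OF N p] D_def using dual is_norm_nonneg[OF N p] by (rule mult_right_mono)
    finally show ?thesis using vc w p by (simp add: minus_scalar_prod_distrib[of _ d])
  qed
  have "(1 - \<sigma> - \<sigma>') / l * D powr r + \<epsilon> \<le> scalar_prod v (x - y)"
  proof -
    have "- (\<sigma> / l * (D powr (r - 1) * D)) \<le> scalar_prod v (x - y) - scalar_prod w (x - y)"
      using vw[of "x - y"] x y by (simp add: D_def mult.assoc)
    then show ?thesis
      using eps prox_subgradient_inner[OF N r l x y w] unfolding DD
      by (simp add: D_def diff_divide_distrib left_diff_distrib)
  qed
  moreover have "- scalar_prod v p \<le> (1 + \<sigma>) / l * D powr (r - 1) * N p" if p: "p \<in> carrier_vec d" for p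
    using vw[OF p] prox_subgradient_bound[OF N r l x y w, of "- p"] p w
    by (simp add: is_norm_uminus[OF N p] D_def add_divide_distrib distrib_right)
  ultimately show ?thesis using v unfolding D_def by blast
qed

section \<open>Gradients and Bregman divergences\<close>

lemma scalar_prod_self_eq_0:
  fixes u :: "real vec"
  assumes "u \<in> carrier_vec d" "scalar_prod u u = 0"
  shows "u = 0\<^sub>v d"
proof -
  have "(\<Sum>i=0..<d. u $ i * u $ i) = 0" using assms by (simp add: scalar_prod_def)
  then have "\<forall>i\<in>{0..<d}. u $ i * u $ i = 0"
    by (subst (asm) sum_nonneg_eq_0_iff) auto
  then show ?thesis using assms(1) by (intro eq_vecI) auto
qed

lemma eucl_norm_square: "(eucl_norm u)\<^sup>2 = scalar_prod u u"
proof -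
  have "scalar_prod u u \<ge> 0" unfolding scalar_prod_def by (intro sum_nonneg) auto
  then show ?thesis by (simp add: eucl_norm_def)
qed

lemma eucl_norm_smult: "t \<ge> 0 \<Longrightarrow> eucl_norm (t \<cdot>\<^sub>v u) = t * eucl_norm u"
  by (simp add: eucl_norm_def real_sqrt_mult)

text \<open>A one-sided first-order bound identifies the gradient: moving from \<open>z\<close>
  along \<open>u = c - g\<close>, the two linear models differ by \<open>t\<close> times the squared
  length of \<open>u\<close>, while the errors are of smaller order unless \<open>u\<close>
  vanishes. This serves both the uniqueness of gradients and the optimality condition at a
  minimiser.\<close>

lemma has_gradient_eqI:
  assumes g: "has_gradient d h z g" and z: "z \<in> carrier_vec d" and c: "c \<in> carrier_vec d"
    and lower: "\<And>e. e > 0 \<Longrightarrow> \<exists>s>0. \<forall>x\<in>carrier_vec d. eucl_norm (x - z) < s \<longrightarrow>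
      - (e * eucl_norm (x - z)) \<le> h x - h z - scalar_prod c (x - z)"
  shows "g = c"
proof -
  have gc: "g \<in> carrier_vec d" using g by (simp add: has_gradient_def)
  define u where "u = c - g"
  have u: "u \<in> carrier_vec d" using gc c by (simp add: u_def)
  define n where "n = eucl_norm u"
  have n: "n \<ge> 0" by (simp add: n_def eucl_norm_def scalar_prod_def sum_nonneg)
  have "n = 0"
  proof (rule ccontr)
    assume "n \<noteq> 0"
    then have n: "n > 0" using n by simp
    obtain s1 where s1: "s1 > 0" "\<And>x. x \<in> carrier_vec d \<Longrightarrow> eucl_norm (x - z) < s1 \<Longrightarrow>
        \<bar>h x - h z - scalar_prod g (x - z)\<bar> \<le> n / 4 * eucl_norm (x - z)"
      using g n unfolding has_gradient_def by (metis zero_less_divide_iff zero_less_numeral)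
    obtain s2 where s2: "s2 > 0" "\<And>x. x \<in> carrier_vec d \<Longrightarrow> eucl_norm (x - z) < s2 \<Longrightarrow>
        - (n / 4 * eucl_norm (x - z)) \<le> h x - h z - scalar_prod c (x - z)"
      using lower[of "n / 4"] n by auto
    \<comment> \<open>Half of the smaller radius in units of \<open>n\<close>, so that
      \<open>q\<close> lies in both neighbourhoods. The two errors with factor \<open>n / 4\<close>
      add up to half of \<open>t * n\<^sup>2\<close>, which is too little.\<close>
    define t where "t = min s1 s2 / (2 * n)"
    have t: "t > 0" "t * n < s1" "t * n < s2" using s1 s2 n by (auto simp: t_def)
    define q where "q = z + t \<cdot>\<^sub>v u"
    have q: "q \<in> carrier_vec d" "q - z = t \<cdot>\<^sub>v u" using z u by (auto simp: q_def)
    have tu: "eucl_norm (t \<cdot>\<^sub>v u) = t * n" using t by (simp add: eucl_norm_smult n_def)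
    have "\<bar>h q - h z - t * scalar_prod g u\<bar> \<le> n / 4 * (t * n)"
      using s1(2)[OF q(1)] gc u t unfolding q(2) tu by simp
    moreover have "- (n / 4 * (t * n)) \<le> h q - h z - t * scalar_prod c u"
      using s2(2)[OF q(1)] c u t unfolding q(2) tu by simp
    ultimately have "t * (scalar_prod c u - scalar_prod g u) \<le> n / 4 * (t * n) + n / 4 * (t * n)"
      unfolding right_diff_distrib by linarith
    also have "scalar_prod c u - scalar_prod g u = n\<^sup>2"
      using minus_scalar_prod_distrib[OF c gc u] by (simp add: n_def eucl_norm_square u_def)
    finally show False using t n by (simp add: power2_eq_square)
  qed
  then have "u = 0\<^sub>v d"
    using scalar_prod_self_eq_0[OF u] eucl_norm_square[of u] by (simp add: n_def)
  then have "u $ i = 0" if "i < d" for i using that by simp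
  then show ?thesis using c gc by (intro eq_vecI) (auto simp: u_def)
qed

text \<open>This makes the \<open>THE\<close> in \<open>gradient\<close> denote an actual
  gradient.\<close>

lemma has_gradient_unique:
  assumes "has_gradient d h z g" "has_gradient d h z g'" "z \<in> carrier_vec d"
  shows "g = g'"
proof (rule has_gradient_eqI[OF assms(1,3)])
  show "g' \<in> carrier_vec d" using assms(2) by (simp add: has_gradient_def)
  fix e :: real assume "e > 0"
  then obtain s where "s > 0" "\<forall>x\<in>carrier_vec d. eucl_norm (x - z) < s \<longrightarrow>
      \<bar>h x - h z - scalar_prod g' (x - z)\<bar> \<le> e * eucl_norm (x - z)"
    using assms(2) unfolding has_gradient_def by blast
  then show "\<exists>s>0. \<forall>x\<in>carrier_vec d. eucl_norm (x - z) < s \<longrightarrow>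
      - (e * eucl_norm (x - z)) \<le> h x - h z - scalar_prod g' (x - z)"
    by (intro exI[of _ s]) (auto simp: abs_le_iff)
qed

lemma has_gradient_gradient:
  assumes "differentiable_fun d h" "y \<in> carrier_vec d"
  shows "has_gradient d h y (gradient d h y)"
proof -
  obtain g where g: "has_gradient d h y g" using assms unfolding differentiable_fun_def by blast
  then have "gradient d h y = g"
    unfolding gradient_def using has_gradient_unique assms(2) by blast
  then show ?thesis using g by simp
qed

lemma bregman_self: "y \<in> carrier_vec d \<Longrightarrow> differentiable_fun d h \<Longrightarrow> bregman d h y y = 0"
  using has_gradient_gradient[of d h y] by (simp add: bregman_def has_gradient_def)

text \<open>The three-point identity: optimality of \<open>z\<close> over the whole space forces the
  gradient of \<open>\<psi>\<close> at \<open>z\<close> to be \<open>g - G\<close>, with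
  \<open>g\<close> the gradient at \<open>x\<close>. Expanding the divergences then gives
  equality.\<close>

lemma bregman_argmin:
  assumes diff: "differentiable_fun d \<psi>"
    and c: "x \<in> carrier_vec d" "z \<in> carrier_vec d" "G \<in> carrier_vec d" "p \<in> carrier_vec d"
    and min: "\<And>p. p \<in> carrier_vec d \<Longrightarrow>
      scalar_prod G z + bregman d \<psi> z x \<le> scalar_prod G p + bregman d \<psi> p x"
  shows "scalar_prod G p + bregman d \<psi> p x = scalar_prod G z + bregman d \<psi> z x + bregman d \<psi> p z"
proof -
  define g where "g = gradient d \<psi> x"
  have g: "g \<in> carrier_vec d"
    using has_gradient_gradient[OF diff c(1)] by (simp add: g_def has_gradient_def)
  have lin: "scalar_prod (g - G) (q - z) = (scalar_prod g (q - x) - scalar_prod g (z - x))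
      - (scalar_prod G q - scalar_prod G z)" if q: "q \<in> carrier_vec d" for q
    using c g q by (simp add: minus_scalar_prod_distrib[of _ d] scalar_prod_minus_distrib[of _ d])
  have "gradient d \<psi> z = g - G"
  \<comment> \<open>Minimality at \<open>z\<close> places \<open>\<psi>\<close> above an affine
    function of slope \<open>g - G\<close> touching it there. The lower bound holds globally, so any
    radius will do.\<close>
  proof (rule has_gradient_eqI[OF has_gradient_gradient[OF diff c(2)] c(2)])
    show "g - G \<in> carrier_vec d" using g c by simp
    fix e :: real assume e: "e > 0"
    have "- (e * eucl_norm (q - z)) \<le> \<psi> q - \<psi> z - scalar_prod (g - G) (q - z)"
      if q: "q \<in> carrier_vec d" for q
    proof -
      have "0 \<le> e * eucl_norm (q - z)"
        using e by (simp add: eucl_norm_def scalar_prod_def sum_nonneg)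
      then show ?thesis
        using min[OF q] lin[OF q] by (simp add: bregman_def g_def)
    qed
    then show "\<exists>s>0. \<forall>q\<in>carrier_vec d. eucl_norm (q - z) < s \<longrightarrow>
        - (e * eucl_norm (q - z)) \<le> \<psi> q - \<psi> z - scalar_prod (g - G) (q - z)"
      by (intro exI[of _ 1]) auto
  qed
  then show ?thesis using lin[OF c(4)] by (simp add: bregman_def g_def)
qed

section \<open>Estimate sequence and convergence\<close>

text \<open>Four inequalities are added: the \<open>\<epsilon>\<close>-subgradient inequality at
  \<open>y\<close> with weight \<open>B\<close>, the oracle progress with weight \<open>A\<close>,
  the bound on \<open>v\<close> at \<open>z' - z\<close> with weight \<open>a\<close>, and the step
  size inequality. The error \<open>\<epsilon>\<close> enters with weights \<open>B\<close> and
  \<open>A\<close>, whose difference \<open>a\<close> is the weight in the conclusion.\<close>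

lemma accelerated_step:
  assumes N: "is_norm d N" and r: "r > 1" and mu: "\<mu> > 0" and s: "0 \<le> \<sigma>" "\<sigma> + \<sigma>' < 1"
    and pos: "B \<ge> 0" "a > 0" "l > 0" and A: "A = B + a"
    and step: "a powr r = step_constant r \<mu> \<sigma> \<sigma>' * A powr (r - 1) * l"
    and c: "y \<in> carrier_vec d" "y' \<in> carrier_vec d" "z \<in> carrier_vec d" "z' \<in> carrier_vec d"
    and x: "x = (B / A) \<cdot>\<^sub>v y + (a / A) \<cdot>\<^sub>v z"
    and v: "v \<in> eps_subdifferential d \<epsilon> f y'"
    and inner: "(1 - \<sigma> - \<sigma>') / l * N (x - y') powr r + \<epsilon> \<le> scalar_prod v (x - y')"
    and bound: "\<And>p. p \<in> carrier_vec d \<Longrightarrow> - scalar_prod v p \<le> (1 + \<sigma>) / l * N (x - y') powr (r - 1) * N p"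
  shows "A * f y' \<le> B * f y + a * (f y' + scalar_prod v (z' - y') - \<epsilon>) + \<mu> / r * N (z' - z) powr r"
proof -
  have vc: "v \<in> carrier_vec d" and fy: "f y \<ge> f y' + scalar_prod v (y - y') - \<epsilon>"
    using v c by (auto simp: eps_subdifferential_def)
  have A_pos: "A > 0" using pos A by simp
  have xc: "x \<in> carrier_vec d" using c by (simp add: x)
  have "scalar_prod v x = B / A * scalar_prod v y + a / A * scalar_prod v z"
    using vc c by (simp add: x scalar_prod_add_distrib[of _ d])
  then have Ax: "A * scalar_prod v x = B * scalar_prod v y + a * scalar_prod v z"
    using A_pos by (simp add: field_simps)
  have "B * (f y' + scalar_prod v (y - y') - \<epsilon>) \<le> B * f y"
    using fy pos by (intro mult_left_mono)
  moreover have "A * ((1 - \<sigma> - \<sigma>') / l * N (x - y') powr r + \<epsilon>) \<le> A * scalar_prod v (x - y')"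
    using inner A_pos by (intro mult_left_mono) auto
  moreover have "a * (- scalar_prod v (z' - z)) \<le> a * ((1 + \<sigma>) / l * N (x - y') powr (r - 1) * N (z' - z))"
    using bound[of "z' - z"] c pos by (intro mult_left_mono) auto
  moreover have "a * ((1 + \<sigma>) / l * N (x - y') powr (r - 1) * N (z' - z))
      \<le> A * ((1 - \<sigma> - \<sigma>') / l * N (x - y') powr r) + \<mu> / r * N (z' - z) powr r"
    using xc c is_norm_nonneg[OF N, of "x - y'"] is_norm_nonneg[OF N, of "z' - z"]
    by (intro step_size_inequality[OF r mu s pos(2) A_pos pos(3) _ _ step]) auto
  \<comment> \<open>The linear terms match because \<open>x\<close> is the average of
    \<open>y\<close> and \<open>z\<close> with weights \<open>B / A\<close> and
    \<open>a / A\<close>, and \<open>A = B + a\<close>.\<close>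
  moreover have "A * scalar_prod v (x - y') + a * scalar_prod v (z' - z)
      = B * scalar_prod v (y - y') + a * scalar_prod v (z' - y')"
  proof -
    have "A * scalar_prod v (x - y') = A * scalar_prod v x - A * scalar_prod v y'"
      using vc xc c by (simp add: scalar_prod_minus_distrib[of _ d] right_diff_distrib)
    then show ?thesis unfolding Ax
      using vc c by (simp add: A scalar_prod_minus_distrib[of _ d] algebra_simps)
  qed
  ultimately show ?thesis by (simp add: A algebra_simps)
qed

text \<open>Gathers the linear part of the objective of \<open>z n\<close> into one vector, as
  \<open>bregman_argmin\<close> requires.\<close>

lemma weighted_scalar_prod_sum:
  fixes v :: "nat \<Rightarrow> real vec"
  assumes "\<And>i. i \<ge> 1 \<Longrightarrow> v i \<in> carrier_vec d"
  shows "\<exists>G\<in>carrier_vec d. \<forall>p\<in>carrier_vec d. (\<Sum>i=1..n. a i * scalar_prod (v i) p) = scalar_prod G p"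
proof (induction n)
  case 0
  then show ?case by (intro bexI[of _ "0\<^sub>v d"]) auto
next
  case (Suc n)
  then obtain G where "G \<in> carrier_vec d"
    "\<forall>p\<in>carrier_vec d. (\<Sum>i=1..n. a i * scalar_prod (v i) p) = scalar_prod G p" by blast
  then show ?case using assms[of "Suc n"]
    by (intro bexI[of _ "G + a (Suc n) \<cdot>\<^sub>v v (Suc n)"]) (auto simp: add_scalar_prod_distrib[of _ d])
qed

text \<open>The invariant \<open>main\<close> bounds \<open>A t * f (y t)\<close> by the minimum of
  the estimate function plus one \<open>\<delta>\<close> per step; at \<open>u\<close> that function
  is at most \<open>A t * f u\<close> plus the divergence.\<close>

lemma accelerated_prox_gap:
  assumes N: "is_norm d N" and r: "r > 1" and mu: "\<mu> > 0" and s: "0 \<le> \<sigma>" "\<sigma> + \<sigma>' < 1"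
    and \<psi>: "inexact_uniformly_convex d N \<delta> \<mu> r \<psi>"
    and l: "\<And>k. k \<ge> 1 \<Longrightarrow> l k > 0"
    and run: "accelerated_prox_run d N f \<psi> r \<mu> \<sigma> \<sigma>' l a A x y v z"
    and t: "t \<ge> 1" and u: "u \<in> carrier_vec d"
  shows "A t * (f (y t) - f u) \<le> bregman d \<psi> u (x 0) + \<delta> * real t"
proof -
  have diff: "differentiable_fun d \<psi>" using \<psi> by (simp add: inexact_uniformly_convex_def)
  have uc: "bregman d \<psi> p q \<ge> \<mu> / r * N (p - q) powr r - \<delta>"
    if "p \<in> carrier_vec d" "q \<in> carrier_vec d" for p q
    using \<psi> that by (simp add: inexact_uniformly_convex_def)
  have init: "x 0 \<in> carrier_vec d" "z 0 = x 0" "y 0 = x 0" "A 0 = 0"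
    and a: "\<And>k. k \<ge> 1 \<Longrightarrow> a k > 0"
    and A: "\<And>k. k \<ge> 1 \<Longrightarrow> A k = A (k - 1) + a k"
    and step: "\<And>k. k \<ge> 1 \<Longrightarrow> a k powr r = step_constant r \<mu> \<sigma> \<sigma>' * A k powr (r - 1) * l k"
    and x: "\<And>k. k \<ge> 1 \<Longrightarrow> x k = (A (k - 1) / A k) \<cdot>\<^sub>v y (k - 1) + (a k / A k) \<cdot>\<^sub>v z (k - 1)"
    and prox: "\<And>k. k \<ge> 1 \<Longrightarrow> inexact_prox d N f r \<sigma> \<sigma>' (x k) (l k) (y k) (v k)"
    and argmin: "\<And>k. k \<ge> 1 \<Longrightarrow> is_arg_min (\<lambda>p. (\<Sum>i=1..k. a i * scalar_prod (v i) p) + bregman d \<psi> p (x 0))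
          (\<lambda>p. p \<in> carrier_vec d) (z k)"
    using run unfolding accelerated_prox_run_def by auto
  have zc: "z k \<in> carrier_vec d" for k
    using argmin[of k] init by (cases k) (auto simp: is_arg_min_def)
  have yc: "y k \<in> carrier_vec d" for k
    using prox[of k] init by (cases k) (auto simp: inexact_prox_def)
  have xc: "x k \<in> carrier_vec d" if "k \<ge> 1" for k
    using x[OF that] yc zc by simp
  \<comment> \<open>The oracle errors are only known to exist. One sequence of them is fixed, so
    that all estimate functions share it.\<close>
  have "\<forall>k. \<exists>e. k \<ge> 1 \<longrightarrow> v k \<in> eps_subdifferential d e f (y k)
      \<and> (1 - \<sigma> - \<sigma>') / l k * N (x k - y k) powr r + e \<le> scalar_prod (v k) (x k - y k)
      \<and> (\<forall>p\<in>carrier_vec d. - scalar_prod (v k) p \<le> (1 + \<sigma>) / l k * N (x k - y k) powr (r - 1) * N p)"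
    using inexact_prox_bounds[OF N r l xc prox] by blast
  from choice[OF this]
  obtain \<epsilon> where \<epsilon>: "\<And>k. k \<ge> 1 \<Longrightarrow> v k \<in> eps_subdifferential d (\<epsilon> k) f (y k)
      \<and> (1 - \<sigma> - \<sigma>') / l k * N (x k - y k) powr r + \<epsilon> k \<le> scalar_prod (v k) (x k - y k)
      \<and> (\<forall>p\<in>carrier_vec d. - scalar_prod (v k) p \<le> (1 + \<sigma>) / l k * N (x k - y k) powr (r - 1) * N p)"
    by blast
  have vc: "v k \<in> carrier_vec d" if "k \<ge> 1" for k
    using \<epsilon>[OF that] by (simp add: eps_subdifferential_def)
  have A_nn: "A n \<ge> 0" for n
  proof (induction n)
    case (Suc n)
    then show ?case using A[of "Suc n"] a[of "Suc n"] by simp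
  qed (simp add: init)
  have A_sum: "A n = (\<Sum>i=1..n. a i)" for n
  proof (induction n)
    case (Suc n)
    then show ?case using A[of "Suc n"] by simp
  qed (simp add: init)
  define lin where "lin = (\<lambda>n p. \<Sum>i=1..n. a i * (f (y i) + scalar_prod (v i) (p - y i) - \<epsilon> i))"
  define \<Phi> where "\<Phi> = (\<lambda>n p. lin n p + bregman d \<psi> p (x 0))"
  \<comment> \<open>Up to a constant, \<open>lin n\<close> is the linear part of the objective that
    \<open>z n\<close> minimises, so \<open>z n\<close> minimises \<open>\<Phi> n\<close> as
    well.\<close>
  have lin_eq: "lin n p = (\<Sum>i=1..n. a i * scalar_prod (v i) p)
      + (\<Sum>i=1..n. a i * (f (y i) - scalar_prod (v i) (y i) - \<epsilon> i))" if p: "p \<in> carrier_vec d" for n p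
    unfolding lin_def sum.distrib[symmetric]
    using p vc yc by (intro sum.cong) (auto simp: scalar_prod_minus_distrib[of _ d] algebra_simps)
  have \<Phi>_min: "\<Phi> n (z n) \<le> \<Phi> n p" if n: "n \<ge> 1" and p: "p \<in> carrier_vec d" for n p
    using argmin[OF n] p zc[of n] by (auto simp: \<Phi>_def lin_eq is_arg_min_linorder)
  have \<Phi>_eq: "\<Phi> n p = \<Phi> n (z n) + bregman d \<psi> p (z n)" if p: "p \<in> carrier_vec d" for n p
  proof (cases "n = 0")
    \<comment> \<open>No minimality is given for \<open>z 0\<close>; here \<open>lin\<close>
      vanishes and \<open>z 0 = x 0\<close>.\<close>
    case True
    then show ?thesis using init diff by (simp add: \<Phi>_def lin_def bregman_self)
  next
    case False
    obtain G where G: "G \<in> carrier_vec d"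
      "\<And>p. p \<in> carrier_vec d \<Longrightarrow> (\<Sum>i=1..n. a i * scalar_prod (v i) p) = scalar_prod G p"
      using weighted_scalar_prod_sum[of v d, OF vc] by metis
    have "scalar_prod G p + bregman d \<psi> p (x 0)
        = scalar_prod G (z n) + bregman d \<psi> (z n) (x 0) + bregman d \<psi> p (z n)"
      using argmin[of n] False G zc
      by (intro bregman_argmin[OF diff init(1) zc G(1) p]) (auto simp: is_arg_min_linorder)
    then show ?thesis using G(2) p zc by (simp add: \<Phi>_def lin_eq)
  qed
  have main: "A n * f (y n) \<le> \<Phi> n (z n) + real n * \<delta>" for n
  proof (induction n)
    case 0
    then show ?case using init diff by (simp add: \<Phi>_def lin_def bregman_self)
  next
    case (Suc n)
    have "A (Suc n) * f (y (Suc n)) \<le> A n * f (y n)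
        + a (Suc n) * (f (y (Suc n)) + scalar_prod (v (Suc n)) (z (Suc n) - y (Suc n)) - \<epsilon> (Suc n))
        + \<mu> / r * N (z (Suc n) - z n) powr r"
      using \<epsilon>[of "Suc n"] a[of "Suc n"] l[of "Suc n"] A[of "Suc n"] step[of "Suc n"] x[of "Suc n"] A_nn[of n]
      by (intro accelerated_step[OF N r mu s, where l = "l (Suc n)"]) (auto simp: yc zc)
    also have "A n * f (y n) \<le> \<Phi> n (z n) + real n * \<delta>" by (rule Suc.IH)
    \<comment> \<open>Uniform convexity between consecutive \<open>z\<close> costs one
      \<open>\<delta>\<close>. By \<open>\<Phi>_eq\<close> the divergence moves
      \<open>\<Phi> n\<close> from \<open>z n\<close> to \<open>z (Suc n)\<close>.\<close>
    also have "\<mu> / r * N (z (Suc n) - z n) powr r \<le> bregman d \<psi> (z (Suc n)) (z n) + \<delta>"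
      using uc[OF zc zc, of "Suc n" n] by simp
    finally show ?case
      using \<Phi>_eq[OF zc, of n "Suc n"] by (simp add: \<Phi>_def lin_def algebra_simps)
  qed
  have "lin t u \<le> (\<Sum>i=1..t. a i * f u)"
    unfolding lin_def
  proof (intro sum_mono mult_left_mono)
    fix i assume i: "i \<in> {1..t}"
    then show "a i \<ge> 0" using a[of i] by simp
    show "f (y i) + scalar_prod (v i) (u - y i) - \<epsilon> i \<le> f u"
      using \<epsilon>[of i] i u by (auto simp: eps_subdifferential_def)
  qed
  also have "\<dots> = A t * f u" by (simp add: A_sum sum_distrib_right)
  finally show ?thesis
    using main[of t] \<Phi>_min[OF t u] by (simp add: \<Phi>_def algebra_simps)
qed

theorem theorem8:
  fixes r \<sigma> \<sigma>' :: real
  assumes "r > 1"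
    and "0 \<le> \<sigma>" "\<sigma> < 1 / 2"
    and "0 \<le> \<sigma>'" "\<sigma>' < 1 / 2"
  shows "\<exists>K::real. K > 0 \<and>
    (\<forall>(d::nat) (f :: real vec \<Rightarrow> real) (N :: real vec \<Rightarrow> real) (\<psi> :: real vec \<Rightarrow> real)
       (\<mu>::real) (\<delta>::real) (l :: nat \<Rightarrow> real) (a :: nat \<Rightarrow> real) (A :: nat \<Rightarrow> real)
       (x :: nat \<Rightarrow> real vec) (y :: nat \<Rightarrow> real vec) (v :: nat \<Rightarrow> real vec) (z :: nat \<Rightarrow> real vec).
       convex_fun d f \<longrightarrow> is_norm d N \<longrightarrow> \<mu> > 0 \<longrightarrow> \<delta> \<ge> 0 \<longrightarrow>
       inexact_uniformly_convex d N \<delta> \<mu> r \<psi> \<longrightarrow>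
       (\<forall>k\<ge>1. l k > 0) \<longrightarrow>
       accelerated_prox_run d N f \<psi> r \<mu> \<sigma> \<sigma>' l a A x y v z \<longrightarrow>
       (\<forall>t\<ge>1. \<forall>u\<in>carrier_vec d.
          f (y t) - f u
            \<le> K * ((bregman d \<psi> u (x 0) + \<delta> * real t) /
                    (\<mu> * (\<Sum>k=1..t. l k powr (1 / r)) powr r))))"
proof -
  have s: "\<sigma> + \<sigma>' < 1" using assms by simp
  \<comment> \<open>\<open>step_constant\<close> is proportional to \<open>\<mu>\<close>, so its
    value at \<open>\<mu> = 1\<close> depends only on \<open>r\<close>, \<open>\<sigma>\<close> and
    \<open>\<sigma>'\<close>. \<open>K\<close> is the inverse of the factor
    \<open>c / r powr r\<close> left by \<open>root_growth\<close>.\<close>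
  define c where "c = step_constant r 1 \<sigma> \<sigma>'"
  have c: "c > 0" unfolding c_def using step_constant_pos[OF assms(1) _ s] by simp
  define K where "K = r powr r / c"
  have K: "K > 0" using c assms(1) by (simp add: K_def)
  have "f (y t) - f u \<le> K * ((bregman d \<psi> u (x 0) + \<delta> * real t) /
                    (\<mu> * (\<Sum>k=1..t. l k powr (1 / r)) powr r))"
    if N: "is_norm d N" and mu: "\<mu> > 0" and \<delta>: "\<delta> \<ge> 0"
      and \<psi>: "inexact_uniformly_convex d N \<delta> \<mu> r \<psi>" and l: "\<forall>k\<ge>1. l k > 0"
      and run: "accelerated_prox_run d N f \<psi> r \<mu> \<sigma> \<sigma>' l a A x y v z"
      and t: "t \<ge> 1" and u: "u \<in> carrier_vec d"
    for d f N \<psi> \<mu> \<delta> l a A x y v z t u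
  proof -
    have C: "step_constant r \<mu> \<sigma> \<sigma>' = \<mu> * c" by (simp add: c_def step_constant_def)
    define S where "S = (\<Sum>k=1..t. l k powr (1 / r)) powr r"
    have "(\<Sum>k=1..t. l k powr (1 / r)) > 0" using l t by (intro sum_pos) auto
    then have S: "S > 0" by (simp add: S_def)
    define E where "E = bregman d \<psi> u (x 0) + \<delta> * real t"
    \<comment> \<open>Replacing \<open>A t\<close> by its lower bound in the denominator below
      requires \<open>E \<ge> 0\<close>. The divergence may be as low as \<open>- \<delta>\<close>,
      which \<open>\<delta> * real t\<close> compensates since \<open>t \<ge> 1\<close>.\<close>
    have "x 0 \<in> carrier_vec d" using run by (simp add: accelerated_prox_run_def)
    then have "bregman d \<psi> u (x 0) \<ge> \<mu> / r * N (u - x 0) powr r - \<delta>"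
      using \<psi> u by (simp add: inexact_uniformly_convex_def)
    moreover have "\<mu> / r * N (u - x 0) powr r \<ge> 0" using mu assms(1) by simp
    moreover have "\<delta> \<le> \<delta> * real t" using t \<delta> mult_left_mono[of 1 "real t" \<delta>] by simp
    ultimately have E: "E \<ge> 0" by (simp add: E_def)
    have "\<mu> * c / r powr r * S \<le> A t"
      unfolding S_def using run l mu c assms(1)
      by (intro root_growth[where a = a]) (auto simp: accelerated_prox_run_def C)
    then have At: "\<mu> * S / K \<le> A t" by (simp add: K_def mult_ac)
    have pos: "\<mu> * S / K > 0" using mu S K by simp
    have "A t * (f (y t) - f u) \<le> E"
      unfolding E_def using l by (intro accelerated_prox_gap[OF N assms(1) mu assms(2) s \<psi> _ run t u]) auto
    then have "f (y t) - f u \<le> E / A t" using At pos by (simp add: field_simps)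
    also have "\<dots> \<le> E / (\<mu> * S / K)" using E At pos by (intro divide_left_mono mult_pos_pos) linarith+
    also have "\<dots> = K * (E / (\<mu> * S))" by simp
    finally show ?thesis by (simp add: E_def S_def)
  qed
  then show ?thesis using K by blast
qed

end
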